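(* Let $k$ be an algebraically closed field of characteristic zero and let $L$ be an $n$-dimensional filiform Lie algebra over $k$. Put $q=[(n+1)/2]$. Then $H=C^{n-q}(L)$ is a $q$-dimensional abelian ideal of $L$, i.e. $\alpha(L)\ge q$. Assume in addition that $L$ has minimal index (i.e. $i(L)=1$ if $n$ is odd and $i(L)=2$ if $n$ is even). Then $L$ satisfies Rentschler's property. More precisely: (1) If $i(L)=1$ (so $n$ is odd), then $H$ is a CP of $L$ and $\alpha(L)=q$. (2) If $i(L)=2$ (so $n$ is even), then $\dim H=q=c(L)-1$ (but the existence of a CP of $L$ is still possible).
   Context: $[r]$ denotes the greatest integer $\le r$. Let $C^1(L)=L$, $C^i(L)=[L,C^{i-1}(L)]$ for $i\ge 2$, be the descending central series. An $n$-dimensional Lie algebra $L$ is filiform if $\dim C^i(L)=n-i$ for $i=2,\dots,n$. For $\xi\in L^*$ put $L(\xi)=\{x\in L : \xi([x,y])=0 \text{ for all } y\in L\}$; the index is $i(L)=\min_{\xi\in L^*}\dim L(\xi)$; the magic number is $c(L)=(\dim L+i(L))/2$ (an integer). $\alpha(L)$ denotes the maximum dimension of an abelian subalgebra of $L$. A CP (commutative polarization) of $L$ is a commutative subalgebra $P$ of $L$ with $\dim P=c(L)$. $L$ satisfies Rentschler's property if it admits either a CP or an abelian subalgebra of dimension $c(L)-1$, in other words if $\alpha(L)\ge c(L)-1$.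
   Formalization: The claims about H = C^{n-q}(L) (abelian ideal, dim H = q, H is a CP) are stated only for n ≥ 4: for n = 2, 3 one gets H = L with dim L ≠ q (e.g. the Heisenberg algebra), and for n ≤ 1 H = C^0(L) is undefined. All other claims are stated for every n. *)

theory Defs
  imports "HOL-Analysis.Analysis"
begin

text \<open>
  A Lie algebra over the field \<^typ>\<open>'k\<close> whose underlying vector space is the whole
  type \<^typ>\<open>'v\<close>. Subspaces, ideals etc. are subsets of \<^typ>\<open>'v\<close>.
\<close>

locale lie_algebra = vector_space scale
  for scale :: "'k::field \<Rightarrow> 'v::ab_group_add \<Rightarrow> 'v" +
  fixes bracket :: "'v \<Rightarrow> 'v \<Rightarrow> 'v"
  assumes linear_left: "Vector_Spaces.linear scale scale (\<lambda>x. bracket x y)"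
    and linear_right: "Vector_Spaces.linear scale scale (\<lambda>y. bracket x y)"
    and alternating: "bracket x x = 0"
    and jacobi: "bracket x (bracket y z) + bracket y (bracket z x) + bracket z (bracket x y) = 0"
begin

definition bracket_set :: "'v set \<Rightarrow> 'v set \<Rightarrow> 'v set" where
  "bracket_set A B = span {bracket x y | x y. x \<in> A \<and> y \<in> B}"

text \<open>
  The series is indexed from 1, i.e. \<open>lower_central 1 = L\<close>; the value at index 0 is a
  convention only.
\<close>

fun lower_central :: "nat \<Rightarrow> 'v set" where
  "lower_central 0 = UNIV"
| "lower_central (Suc 0) = UNIV"
| "lower_central (Suc (Suc i)) = bracket_set UNIV (lower_central (Suc i))"

definition subalgebra :: "'v set \<Rightarrow> bool" where
  "subalgebra A \<longleftrightarrow> subspace A \<and> (\<forall>x\<in>A. \<forall>y\<in>A. bracket x y \<in> A)"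

definition ideal :: "'v set \<Rightarrow> bool" where
  "ideal I \<longleftrightarrow> subspace I \<and> (\<forall>x. \<forall>y\<in>I. bracket x y \<in> I)"

definition abelian_subalgebra :: "'v set \<Rightarrow> bool" where
  "abelian_subalgebra A \<longleftrightarrow> subalgebra A \<and> (\<forall>x\<in>A. \<forall>y\<in>A. bracket x y = 0)"

definition abelian_ideal :: "'v set \<Rightarrow> bool" where
  "abelian_ideal I \<longleftrightarrow> ideal I \<and> (\<forall>x\<in>I. \<forall>y\<in>I. bracket x y = 0)"

definition stabilizer :: "('v \<Rightarrow> 'k) \<Rightarrow> 'v set" where
  "stabilizer \<xi> = {x. \<forall>y. \<xi> (bracket x y) = 0}"

definition index :: nat where
  "index = (LEAST d. \<exists>\<xi>. Vector_Spaces.linear scale (*) \<xi> \<and> d = dim (stabilizer \<xi>))"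

text \<open>Rational-valued, so that neither the halving nor \<open>magic_number - 1\<close> truncates.\<close>

definition magic_number :: rat where
  "magic_number = (of_nat (dim (UNIV :: 'v set)) + of_nat index) / 2"

definition CP :: "'v set \<Rightarrow> bool" where
  "CP P \<longleftrightarrow> abelian_subalgebra P \<and> of_nat (dim P) = magic_number"

definition rentschler_property :: bool where
  "rentschler_property \<longleftrightarrow>
     (\<exists>P. CP P) \<or> (\<exists>A. abelian_subalgebra A \<and> of_nat (dim A) = magic_number - 1)"

end

locale finite_dimensional_lie_algebra = lie_algebra +
  assumes finite_dimensional: "\<exists>B. finite B \<and> span B = UNIV"
begin

definition alpha :: nat where
  "alpha = Max {dim A | A. abelian_subalgebra A}"

definition filiform :: bool where
  "filiform \<longleftrightarrow>
     (\<forall>i\<in>{2..dim (UNIV :: 'b set)}. dim (lower_central i) = dim (UNIV :: 'b set) - i)"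

definition minimal_index :: bool where
  "minimal_index \<longleftrightarrow> index = (if odd (dim (UNIV :: 'b set)) then 1 else 2)"

end

end

theory Submission
  imports Defs
begin

text \<open>
  The descending central series is multiplicative: \<open>[C\<^sup>i, C\<^sup>j] \<subseteq> C\<^sup>i\<^sup>+\<^sup>j\<close>
  (\<open>bracket_lower_central\<close>). For a filiform algebra of dimension \<open>n \<ge> 4\<close> put
  \<open>m = n - q\<close>, so that \<open>H = C\<^sup>m\<close> has dimension \<open>n - m = q\<close>. Since \<open>2 m + 1 \<ge> n\<close> and
  \<open>C\<^sup>n = 0\<close>, the ideals \<open>H\<close> and \<open>C\<^sup>m\<^sup>+\<^sup>1\<close> commute. But \<open>m \<ge> 2\<close> makes \<open>C\<^sup>m\<^sup>+\<^sup>1\<close> of codimension one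
  in \<open>H\<close>, and a line commutes with itself, so \<open>H\<close> is abelian (\<open>filiform_half_step\<close>). This
  last remark is what saves the odd case, in which \<open>2 m < n\<close>. When \<open>n \<le> 3\<close> an abelian
  subalgebra of dimension \<open>q\<close> is spanned by at most two commuting vectors.

  The upper bound holds for every finite-dimensional Lie algebra. If \<open>\<xi>\<close> realises the index, an abelian
  subalgebra is totally isotropic for the form \<open>\<xi> [x, y]\<close>, whose radical has dimension
  \<open>i(L)\<close>; hence its dimension is at most \<open>(n + i(L)) / 2 = c(L)\<close>
  (\<open>dim_abelian_subalgebra_le\<close>). For minimal index \<open>c(L)\<close> equals \<open>q\<close> or \<open>q + 1\<close> according as
  \<open>n\<close> is odd or even, and the remaining claims are arithmetic.

  That a commutative polarization can exist in the even case is witnessed in dimension four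
  by the algebra with \<open>[e\<^sub>1, e\<^sub>2] = e\<^sub>3\<close> and \<open>[e\<^sub>1, e\<^sub>3] = e\<^sub>4\<close>: it has index two, and
  \<open>e\<^sub>2, e\<^sub>3, e\<^sub>4\<close> commute.
\<close>

section \<open>Totally isotropic subspaces of a bilinear form\<close>

context finite_dimensional_vector_space
begin

text \<open>
  Rank-nullity for the restriction of \<open>T\<close> to \<open>A\<close>: on a complement of the kernel in \<open>A\<close> the
  map is injective, so a basis of that complement has an independent image in \<open>span W\<close>.
\<close>

lemma dim_le_dim_kernel_plus_card:
  assumes lin: "Vector_Spaces.linear scale scale T"
    and A: "subspace A"
    and finW: "finite W"
    and TW: "T ` A \<subseteq> span W"
  shows "dim A \<le> dim (A \<inter> {x. T x = 0}) + card W"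
proof -
  interpret T: Vector_Spaces.linear scale scale T by (rule lin)
  define K where "K = A \<inter> {x. T x = 0}"
  have subK: "subspace K"
    unfolding K_def by (intro subspace_inter A T.subspace_kernel)
  obtain BK where BK: "BK \<subseteq> K" "independent BK" "K \<subseteq> span BK" "card BK = dim K"
    using basis_exists[of K] by metis
  have BKA: "BK \<subseteq> A" using BK(1) K_def by auto
  obtain D where D: "BK \<subseteq> D" "D \<subseteq> A" "independent D" "A \<subseteq> span D"
    using maximal_independent_subset_extend[OF BKA BK(2)] by blast
  have finD: "finite D" using D(3) by (rule finiteI_independent)
  define E where "E = D - BK"
  have E: "E \<subseteq> A" "independent E" "E \<union> BK = D" "finite E"
    using D independent_mono[of D E] finD by (auto simp: E_def)
  have cardD: "card D = dim A"
    using D by (metis basis_card_eq_dim)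
  have cardE: "card E + card BK = card D"
    unfolding E_def using D(1) finD
    by (metis card_Diff_subset card_mono finite_subset le_add_diff_inverse2)
  \<comment> \<open>By counting, a basis of \<open>K\<close> and its completion to a basis of \<open>A\<close> span subspaces that meet only in \<open>0\<close>.\<close>
  have "dim (span (E \<union> BK)) + dim (span E \<inter> span BK) = dim (span E) + dim (span BK)"
    unfolding span_Un by (rule dim_sums_Int) auto
  then have "dim (span E \<inter> span BK) = 0"
    using E BK cardE D(3) by (simp add: dim_eq_card_independent)
  then have disj: "span E \<inter> span BK \<subseteq> {0}" by (metis dim_eq_0)
  have "inj_on T (span E)"
  proof (subst T.inj_on_iff_eq_0[OF subspace_span], intro ballI impI)
    fix x assume x: "x \<in> span E" "T x = 0"
    moreover have "span E \<subseteq> A" using E(1) A by (rule span_minimal)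
    ultimately have "x \<in> K" unfolding K_def by auto
    then show "x = 0" using x disj BK(3) by blast
  qed
  moreover have "T ` E \<subseteq> span W" using E(1) TW by blast
  ultimately have "card E \<le> card W"
    using independent_span_bound[OF finW, of "T ` E"] T.independent_injective_image[OF E(2)]
    by (metis card_image inj_on_subset span_superset)
  then show ?thesis using cardE cardD BK(4) unfolding K_def by simp
qed

text \<open>
  An isotropic subspace \<open>A\<close> pairs trivially with itself, so the map from \<open>A\<close> to the dual of the
  whole space takes values in the dual of the quotient by \<open>A\<close>; its kernel lies in the radical.
\<close>

lemma dim_isotropic_le:
  fixes form :: "'b \<Rightarrow> 'b \<Rightarrow> 'a"
  assumes left: "\<And>y. Vector_Spaces.linear scale (*) (\<lambda>x. form x y)"
    and right: "\<And>x. Vector_Spaces.linear scale (*) (form x)"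
    and A: "subspace A"
    and iso: "\<And>x y. x \<in> A \<Longrightarrow> y \<in> A \<Longrightarrow> form x y = 0"
  shows "2 * dim A \<le> dim (UNIV :: 'b set) + dim {x. \<forall>y. form x y = 0}"
proof -
  have form_add: "form (x + x') y = form x y + form x' y"
    and form_scale: "form (scale c x) y = c * form x y" for x x' y c
    using left[of y] by (auto simp: Vector_Spaces.linear_iff)
  obtain BA where BA: "BA \<subseteq> A" "independent BA" "A \<subseteq> span BA" "card BA = dim A"
    using basis_exists[of A] by metis
  obtain B where B: "BA \<subseteq> B" "independent B" "UNIV \<subseteq> span B"
    using BA(2) maximal_independent_subset_extend[of BA UNIV] by auto
  define W where "W = B - BA"
  have finB: "finite B" using B(2) by (rule finiteI_independent)
  have cardB: "card B = dim (UNIV :: 'b set)"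
    using B(2,3) by (metis basis_card_eq_dim subset_UNIV)
  have cardW: "card W + dim A = dim (UNIV :: 'b set)"
    unfolding W_def using BA(4) B(1) finB cardB
    by (metis card_Diff_subset card_mono finite_subset le_add_diff_inverse2)
  have indW: "independent W" using B(2) W_def independent_mono by blast
  have finW: "finite W" using finB W_def by auto
  \<comment> \<open>The dual of the quotient by \<open>A\<close> is modelled on a complement of \<open>A\<close> with basis \<open>W\<close>: the functional \<open>form x\<close> is recorded by its values on \<open>W\<close>, used as coefficients of \<open>W\<close>.\<close>
  define T where "T x = (\<Sum>w\<in>W. scale (form x w) w)" for x
  have lin_T: "Vector_Spaces.linear scale scale T"
    unfolding Vector_Spaces.linear_iff T_def
    by (auto simp: vector_space_axioms form_add form_scale scale_left_distrib sum.distrib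
        scale_sum_right)
  have T_span: "T ` A \<subseteq> span W"
    unfolding T_def by (auto intro!: span_sum span_scale intro: span_base)
  have "A \<inter> {x. T x = 0} \<subseteq> {x. \<forall>y. form x y = 0}"
  proof safe
    fix x y assume x: "x \<in> A" "T x = 0"
    have W0: "form x w = 0" if "w \<in> W" for w
      using independentD[OF indW finW order_refl _ that] x(2) unfolding T_def by blast
    have B0: "form x b = 0" if "b \<in> B" for b
      using W0[of b] iso[OF x(1), of b] that BA(1) W_def by blast
    interpret f: Vector_Spaces.linear scale "(*)" "form x" by (rule right)
    show "form x y = 0" using f.eq_0_on_span[of B y] B0 B(3) by auto
  qed
  then have "dim (A \<inter> {x. T x = 0}) \<le> dim {x. \<forall>y. form x y = 0}"
    by (rule dim_subset)
  then show ?thesis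
    using dim_le_dim_kernel_plus_card[OF lin_T A finW T_span] cardW by linarith
qed

end

lemma vector_space_mult: "vector_space ((*) :: 'k::field \<Rightarrow> 'k \<Rightarrow> 'k)"
  by unfold_locales (simp_all add: algebra_simps)

section \<open>The descending central series\<close>

context lie_algebra
begin

lemma bracket_add_left: "bracket (x + y) z = bracket x z + bracket y z"
  and bracket_scale_left: "bracket (scale c x) z = scale c (bracket x z)"
  using linear_left[of z] by (auto simp: Vector_Spaces.linear_iff)

lemma bracket_add_right: "bracket z (x + y) = bracket z x + bracket z y"
  and bracket_scale_right: "bracket z (scale c x) = scale c (bracket z x)"
  using linear_right[of z] by (auto simp: Vector_Spaces.linear_iff)

lemma bracket_zero_left: "bracket 0 z = 0"
  using bracket_scale_left[of 0 0 z] by simp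

lemma bracket_zero_right: "bracket z 0 = 0"
  using bracket_scale_right[of z 0 0] by simp

lemma bracket_antisym: "bracket x y = - bracket y x"
proof -
  have "0 = bracket (x + y) (x + y)" by (simp add: alternating)
  also have "\<dots> = bracket x y + bracket y x"
    unfolding bracket_add_left bracket_add_right by (simp add: alternating)
  finally show ?thesis by (simp add: eq_neg_iff_add_eq_0)
qed

lemma bracket_derivation: "bracket (bracket x y) z = bracket x (bracket y z) - bracket y (bracket x z)"
  using jacobi[of x y z] bracket_antisym[of z "bracket x y"] bracket_antisym[of z x]
    bracket_scale_right[of y "-1" "bracket x z"]
  by (simp add: algebra_simps)

lemma subspace_bracket_preimage_left: "subspace S \<Longrightarrow> subspace {x. bracket x z \<in> S}"
  and subspace_bracket_preimage_right: "subspace S \<Longrightarrow> subspace {x. bracket z x \<in> S}"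
  by (auto simp: subspace_def bracket_add_left bracket_scale_left bracket_zero_left
      bracket_add_right bracket_scale_right bracket_zero_right)

lemma subspace_lower_central: "subspace (lower_central i)"
  by (induction i rule: lower_central.induct) (auto simp: bracket_set_def)

lemma bracket_mem_lower_central_Suc:
  assumes "i \<ge> 1" "y \<in> lower_central i"
  shows "bracket x y \<in> lower_central (Suc i)"
proof -
  obtain j where "i = Suc j" using assms(1) by (cases i) auto
  then show ?thesis using assms(2) by (auto simp: bracket_set_def intro!: span_base)
qed

lemma lower_central_Suc_le: "lower_central (Suc i) \<subseteq> lower_central i"
proof (induction i rule: lower_central.induct)
  case (3 i)
  show ?case
    unfolding lower_central.simps(3) bracket_set_def
    by (intro span_mono) (use 3 in \<open>auto simp: bracket_set_def\<close>)
qed auto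

text \<open>
  Induction on \<open>i\<close>: a generator \<open>[u, v]\<close> of the next term acts on \<open>y\<close> as
  \<open>[u, [v, y]] - [v, [u, y]]\<close>. The first summand gains its extra degree from the outer \<open>u\<close>, the
  second from the inner one, which is why \<open>j\<close> must vary in the induction.
\<close>

lemma bracket_lower_central:
  assumes "i \<ge> 1" "j \<ge> 1" "x \<in> lower_central i" "y \<in> lower_central j"
  shows "bracket x y \<in> lower_central (i + j)"
  using assms
proof (induction i arbitrary: j x y rule: lower_central.induct)
  case 2
  then show ?case using bracket_mem_lower_central_Suc by simp
next
  case (3 i)
  let ?C = "lower_central (Suc (Suc i) + j)"
  have "bracket (bracket u v) y \<in> ?C" if v: "v \<in> lower_central (Suc i)" for u v
  proof -
    have "bracket v y \<in> lower_central (Suc i + j)"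
      using 3 v by auto
    then have "bracket u (bracket v y) \<in> ?C"
      using bracket_mem_lower_central_Suc[of "Suc i + j"] by simp
    moreover have "bracket v (bracket u y) \<in> lower_central (Suc i + Suc j)"
      using 3(1)[of "Suc j"] v bracket_mem_lower_central_Suc[OF \<open>j \<ge> 1\<close> \<open>y \<in> _ j\<close>] by simp
    ultimately show ?thesis
      unfolding bracket_derivation by (intro subspace_diff subspace_lower_central) simp_all
  qed
  then have "{bracket u v |u v. u \<in> UNIV \<and> v \<in> lower_central (Suc i)} \<subseteq> {x. bracket x y \<in> ?C}"
    by auto
  then have "lower_central (Suc (Suc i)) \<subseteq> {x. bracket x y \<in> ?C}"
    unfolding lower_central.simps(3) bracket_set_def
    by (intro span_minimal subspace_bracket_preimage_left subspace_lower_central)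
  then show ?case using 3 by auto
qed auto

lemma ideal_lower_central: "ideal (lower_central i)"
proof (cases i)
  case (Suc j)
  then show ?thesis
    unfolding ideal_def
    using subspace_lower_central bracket_mem_lower_central_Suc[of i] lower_central_Suc_le[of i]
    by auto
qed (simp add: ideal_def)

section \<open>Abelian subalgebras\<close>

lemma abelian_ideal_imp_abelian_subalgebra: "abelian_ideal I \<Longrightarrow> abelian_subalgebra I"
  unfolding abelian_ideal_def abelian_subalgebra_def ideal_def subalgebra_def by blast

lemma span_commute:
  assumes "\<And>x y. x \<in> S \<Longrightarrow> y \<in> T \<Longrightarrow> bracket x y = 0"
    and "x \<in> span S" "y \<in> span T"
  shows "bracket x y = 0"
proof -
  have "bracket u y = 0" if "u \<in> S" for u
    using span_minimal[of T "{y. bracket u y \<in> {0}}"] subspace_bracket_preimage_right[of "{0}" u]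
      assms that by auto
  then show ?thesis
    using span_minimal[of S "{x. bracket x y \<in> {0}}"] subspace_bracket_preimage_left[of "{0}" y]
      assms(2) by auto
qed

lemma abelian_subalgebra_span:
  assumes "\<And>x y. x \<in> S \<Longrightarrow> y \<in> S \<Longrightarrow> bracket x y = 0"
  shows "abelian_subalgebra (span S)"
  using span_commute[OF assms] span_zero
  unfolding abelian_subalgebra_def subalgebra_def by auto

end

context finite_dimensional_lie_algebra
begin

lemma ex_finite_dimensional_vector_space: "\<exists>B. finite_dimensional_vector_space scale B"
proof -
  obtain F where F: "finite F" "span F = UNIV" using finite_dimensional by blast
  obtain B where "B \<subseteq> F" "independent B" "F \<subseteq> span B"
    using maximal_independent_subset[of F] by blast
  moreover have "span B = UNIV"
    using span_mono[OF \<open>F \<subseteq> span B\<close>] F(2) by (simp add: span_span top.extremum_unique)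
  moreover have "finite B" using \<open>B \<subseteq> F\<close> F(1) by (rule finite_subset)
  ultimately have "finite_dimensional_vector_space scale B" by unfold_locales
  then show ?thesis ..
qed


text \<open>
  The choice of a basis is immaterial; it only gives access to the finite-dimensional theory.
\<close>

interpretation fd: finite_dimensional_vector_space scale
  "SOME B. finite_dimensional_vector_space scale B"
  using ex_finite_dimensional_vector_space by (rule someI_ex)

lemma finite_dims_abelian_subalgebra: "finite {dim A | A. abelian_subalgebra A}"
  by (rule finite_subset[of _ "{..dim (UNIV :: 'b set)}"]) (auto intro: fd.dim_subset simp del: fd.dim_UNIV)

lemma dim_le_alpha: "abelian_subalgebra A \<Longrightarrow> dim A \<le> alpha"
  unfolding alpha_def using finite_dims_abelian_subalgebra by (auto intro: Max_ge)

lemma alpha_le: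
  assumes "\<And>A. abelian_subalgebra A \<Longrightarrow> dim A \<le> d"
  shows "alpha \<le> d"
proof -
  \<comment> \<open>The maximum is over a nonempty set, thanks to the zero subalgebra.\<close>
  have "abelian_subalgebra (span {})" by (rule abelian_subalgebra_span) auto
  then show ?thesis
    unfolding alpha_def using assms finite_dims_abelian_subalgebra by (subst Max_le_iff) auto
qed

text \<open>
  This is the general inequality \<open>\<alpha>(L) \<le> c(L)\<close>, in doubled form to stay within the natural
  numbers. For \<open>\<xi>\<close> realising the index, \<open>A\<close> is totally isotropic for \<open>\<xi> [x, y]\<close>, and the
  radical of that form is the stabilizer of \<open>\<xi>\<close>.
\<close>

lemma dim_abelian_subalgebra_le:
  assumes A: "abelian_subalgebra A"
  shows "2 * dim A \<le> dim (UNIV :: 'b set) + index"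
proof -
  have "Vector_Spaces.linear scale (*) (\<lambda>_. 0)"
    by (simp add: Vector_Spaces.linear_iff vector_space_axioms vector_space_mult)
  then have "\<exists>d \<xi>. Vector_Spaces.linear scale (*) \<xi> \<and> d = dim (stabilizer \<xi>)"
    by blast
  from LeastI_ex[OF this] obtain \<xi>
    where \<xi>: "Vector_Spaces.linear scale (*) \<xi>" "dim (stabilizer \<xi>) = index"
    unfolding index_def by metis
  interpret \<xi>: Vector_Spaces.linear scale "(*)" \<xi> by (rule \<xi>(1))
  have "2 * dim A \<le> dim (UNIV :: 'b set) + dim {x. \<forall>y. \<xi> (bracket x y) = 0}"
  proof (rule fd.dim_isotropic_le)
    show "subspace A" using A by (simp add: abelian_subalgebra_def subalgebra_def)
    show "\<xi> (bracket x y) = 0" if "x \<in> A" "y \<in> A" for x y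
      using A that by (auto simp: abelian_subalgebra_def)
  qed (use \<xi>(1) in \<open>auto simp: Vector_Spaces.linear_iff bracket_add_left bracket_add_right
      bracket_scale_left bracket_scale_right\<close>)
  then show ?thesis using \<xi>(2) by (simp add: stabilizer_def)
qed

section \<open>Filiform Lie algebras\<close>

text \<open>
  The term \<open>C\<^sup>m\<close> with \<open>m = n - q\<close> need not satisfy \<open>2 m \<ge> n\<close>, only \<open>2 m + 1 \<ge> n\<close>, so the
  multiplicativity of the series kills \<open>[C\<^sup>m, C\<^sup>m\<^sup>+\<^sup>1]\<close> and not directly \<open>[C\<^sup>m, C\<^sup>m]\<close>. One extra
  vector \<open>e\<close> spans \<open>C\<^sup>m\<close> over \<open>C\<^sup>m\<^sup>+\<^sup>1\<close>, and \<open>[e, e] = 0\<close> closes the gap. The bound \<open>n \<ge> 4\<close>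
  ensures \<open>m \<ge> 2\<close>: the first step of the series drops the dimension by two, and indeed \<open>C\<^sup>1\<close>
  of the Heisenberg algebra is not abelian.
\<close>

lemma filiform_half_step:
  assumes fil: "filiform"
    and n: "n = dim (UNIV :: 'b set)" "n \<ge> 4"
  defines "H \<equiv> lower_central (n - (n + 1) div 2)"
  shows "abelian_ideal H" and "dim H = (n + 1) div 2"
proof -
  define m where "m = n - (n + 1) div 2"
  have m: "m \<ge> 2" "Suc m \<le> n" "n \<le> 2 * m + 1" using n(2) by (auto simp: m_def)
  have dims: "dim (lower_central i) = n - i" if "2 \<le> i" "i \<le> n" for i
    using fil that n(1) unfolding filiform_def by auto
  have dimH: "dim H = n - m" using dims[of m] m unfolding H_def m_def[symmetric] by simp
  also have "n - m = (n + 1) div 2" using n(2) unfolding m_def by presburger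
  finally show "dim H = (n + 1) div 2" .
  have dimS: "dim (lower_central (Suc m)) = n - Suc m" using dims m by simp
  have "\<not> H \<subseteq> lower_central (Suc m)"
    using fd.dim_subset[of H "lower_central (Suc m)"] dimH dimS m by auto
  then obtain e where e: "e \<in> H" "e \<notin> lower_central (Suc m)" by auto
  let ?K = "lower_central (Suc m)"
  have KH: "?K \<subseteq> H" unfolding H_def m_def by (rule lower_central_Suc_le)
  have sub: "span (insert e ?K) \<subseteq> H"
    using KH e(1) subspace_lower_central by (intro span_minimal) (auto simp: H_def)
  have "e \<notin> span ?K" using e(2) subspace_lower_central by (metis span_eq_iff)
  then have "dim (insert e ?K) = n - m"
    using fd.dim_insert[of e ?K] dimS m by auto
  then have Hspan: "span (insert e ?K) = H"
    using fd.subspace_dim_equal[OF _ _ sub] subspace_lower_central dimH dim_span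
    by (simp add: H_def)
  have "lower_central n = {0}"
    using dims[of n] m fd.dim_eq_0 subspace_0[OF subspace_lower_central] by force
  moreover have "lower_central (Suc (m + m)) \<subseteq> lower_central n"
    using lift_Suc_antimono_le[of lower_central n "Suc (m + m)"] lower_central_Suc_le m by auto
  ultimately have zero: "lower_central (Suc (m + m)) \<subseteq> {0}" by simp
  have left: "bracket x y = 0" if "x \<in> H" "y \<in> ?K" for x y
    using bracket_lower_central[of m "Suc m" x y] that m zero by (auto simp: H_def m_def)
  have "bracket x y = 0" if "x \<in> insert e ?K" "y \<in> insert e ?K" for x y
    using that left[of x y] left[of y x] bracket_antisym[of x y] alternating[of e] e(1) KH by auto
  then have "bracket x y = 0" if "x \<in> H" "y \<in> H" for x y
    using span_commute[of "insert e ?K" "insert e ?K"] that Hspan by blast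
  then show "abelian_ideal H"
    unfolding abelian_ideal_def using ideal_lower_central by (auto simp: H_def)
qed

text \<open>
  In dimensions two and three no term of the series has the required dimension. In dimension three
  \<open>C\<^sup>2\<close> is a central line, and any vector off that line completes it to an abelian plane.
\<close>

lemma filiform_abelian_subalgebra:
  assumes fil: "filiform"
    and n: "n = dim (UNIV :: 'b set)"
  shows "\<exists>A. abelian_subalgebra A \<and> dim A = (n + 1) div 2"
proof -
  have span_case: ?thesis
    if "\<And>x y. x \<in> S \<Longrightarrow> y \<in> S \<Longrightarrow> bracket x y = 0" "independent S" "card S = (n + 1) div 2" for S
  proof (intro exI conjI)
    show "abelian_subalgebra (span S)" using that(1) by (rule abelian_subalgebra_span)
    show "dim (span S) = (n + 1) div 2" using that(2,3) dim_span_eq_card_independent by metis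
  qed
  consider "n = 0" | "n = 1 \<or> n = 2" | "n = 3" | "n \<ge> 4" by linarith
  then show ?thesis
  proof cases
    case 1
    show ?thesis by (rule span_case[of "{}"]) (use 1 in \<open>auto simp: independent_empty\<close>)
  next
    case 2
    then have "\<not> (UNIV :: 'b set) \<subseteq> {0}" using n fd.dim_eq_0[of UNIV] by auto
    then obtain x :: 'b where "x \<noteq> 0" by auto
    then show ?thesis
      by (intro span_case[of "{x}"]) (use 2 in \<open>auto simp: alternating\<close>)
  next
    case 3
    have "dim (lower_central 2) = 1" "dim (lower_central 3) = 0"
      using fil 3 n unfolding filiform_def by auto
    then have "\<not> lower_central 2 \<subseteq> {0}" and C3: "lower_central 3 \<subseteq> {0}"
      by (metis fd.dim_eq_0 zero_neq_one, metis fd.dim_eq_0)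
    then obtain z where z: "z \<in> lower_central 2" "z \<noteq> 0" by auto
    have central: "bracket x z = 0" for x
      using bracket_mem_lower_central_Suc[OF _ z(1), of x] C3 by (auto simp: numeral_3_eq_3)
    have "dim (span {z}) \<le> 1" using dim_le_card[of "span {z}" "{z}"] by simp
    then have "span {z} \<noteq> UNIV" using 3 n by (metis numeral_le_one_iff semiring_norm(70))
    then obtain x where "x \<notin> span {z}" by auto
    with z(2) have "independent {x, z}" "x \<noteq> z"
      by (auto simp: independent_insert span_base)
    then show ?thesis
      by (intro span_case[of "{x, z}"])
        (use 3 central bracket_antisym[of z] in \<open>auto simp: alternating\<close>)
  next
    case 4
    then show ?thesis
      using filiform_half_step[OF fil n] abelian_ideal_imp_abelian_subalgebra by blast
  qed
qed

end

section \<open>The four-dimensional model algebra\<close>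

definition model_bracket :: "'k::field ^ 4 \<Rightarrow> 'k ^ 4 \<Rightarrow> 'k ^ 4" where
  "model_bracket x y = (x $ 1 * y $ 2 - x $ 2 * y $ 1) *s axis 3 1
     + (x $ 1 * y $ 3 - x $ 3 * y $ 1) *s axis 4 1"

lemma model_bracket_nth:
  "model_bracket x y $ 1 = 0"
  "model_bracket x y $ 2 = 0"
  "model_bracket x y $ 3 = x $ 1 * y $ 2 - x $ 2 * y $ 1"
  "model_bracket x y $ 4 = x $ 1 * y $ 3 - x $ 3 * y $ 1"
  by (simp_all add: model_bracket_def axis_def)

interpretation model: finite_dimensional_lie_algebra "(*s)"
  "model_bracket :: 'k::field ^ 4 \<Rightarrow> 'k ^ 4 \<Rightarrow> 'k ^ 4"
proof
  show "\<exists>B :: ('k ^ 4) set. finite B \<and> vec.span B = UNIV"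
    using vec.finite_Basis vec.span_Basis by blast
qed (simp_all add: vec_eq_iff forall_4 model_bracket_nth algebra_simps)

text \<open>
  Coordinate subspaces are easier to recognise by their vanishing coordinates, and easier to
  measure by the axes that span them.
\<close>

lemma span_axes:
  "vec.span ((\<lambda>i. axis i (1::'k::field)) ` I) = {x :: 'k ^ 'n::finite. \<forall>i. i \<notin> I \<longrightarrow> x $ i = 0}"
proof (intro antisym vec.span_minimal)
  show "vec.subspace {x :: 'k ^ 'n. \<forall>i. i \<notin> I \<longrightarrow> x $ i = 0}"
    by (auto simp: vec.subspace_def)
next
  show "{x. \<forall>i. i \<notin> I \<longrightarrow> x $ i = 0} \<subseteq> vec.span ((\<lambda>i. axis i (1::'k)) ` I)"
  proof
    fix x :: "'k ^ 'n" assume x: "x \<in> {x. \<forall>i. i \<notin> I \<longrightarrow> x $ i = 0}"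
    have "x $ i *s axis i 1 \<in> vec.span ((\<lambda>i. axis i (1::'k)) ` I)" for i
      using x by (cases "i \<in> I") (auto intro: vec.span_scale vec.span_base vec.span_zero)
    then have "(\<Sum>i\<in>UNIV. x $ i *s axis i 1) \<in> vec.span ((\<lambda>i. axis i (1::'k)) ` I)"
      by (intro vec.span_sum)
    then show "x \<in> vec.span ((\<lambda>i. axis i (1::'k)) ` I)" by (simp add: basis_expansion)
  qed
qed (auto simp: axis_def)

lemma dim_vanishing_coordinates:
  "vec.dim {x :: 'k::field ^ 'n::finite. \<forall>i. i \<notin> I \<longrightarrow> x $ i = 0} = card I"
proof -
  have "vec.independent ((\<lambda>i. axis i (1::'k)) ` I :: ('k ^ 'n) set)"
    by (rule vec.independent_mono[OF vec.independent_Basis]) (auto simp: cart_basis_def)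
  then show ?thesis
    unfolding span_axes[symmetric]
    by (subst vec.dim_span_eq_card_independent) (auto intro!: card_image inj_onI simp: axis_eq_axis)
qed

text \<open>
  In the model every term of the series is a coordinate subspace, and the brackets of \<open>e\<^sub>1\<close> with
  the axes of one term already reach all the axes of the next.
\<close>

lemma model_lower_central_Suc:
  assumes "i \<ge> 1"
    and "model.lower_central i = {x :: 'k::field ^ 4. \<forall>j. j \<notin> I \<longrightarrow> x $ j = 0}"
    and "\<And>x y :: 'k ^ 4. \<forall>j. j \<notin> I \<longrightarrow> y $ j = 0 \<Longrightarrow> \<forall>j. j \<notin> J \<longrightarrow> model_bracket x y $ j = 0"
    and "\<And>j. j \<in> J \<Longrightarrow> \<exists>k\<in>I. axis j (1::'k) = model_bracket (axis 1 1) (axis k 1)"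
  shows "model.lower_central (Suc i) = {x :: 'k ^ 4. \<forall>j. j \<notin> J \<longrightarrow> x $ j = 0}"
proof -
  have "model.lower_central (Suc i) = model.bracket_set UNIV {x :: 'k ^ 4. \<forall>j. j \<notin> I \<longrightarrow> x $ j = 0}"
    using assms(1,2) by (cases i) auto
  also have "\<dots> = vec.span ((\<lambda>j. axis j 1) ` J)"
    unfolding model.bracket_set_def
  proof (intro antisym vec.span_minimal vec.subspace_span)
    show "{model_bracket x y |x y. x \<in> UNIV \<and> y \<in> {x :: 'k ^ 4. \<forall>j. j \<notin> I \<longrightarrow> x $ j = 0}}
        \<subseteq> vec.span ((\<lambda>j. axis j 1) ` J)"
      unfolding span_axes using assms(3) by blast
    have "axis k (1::'k) \<in> {x. \<forall>j. j \<notin> I \<longrightarrow> x $ j = 0}" if "k \<in> I" for k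
      using that by (auto simp: axis_def)
    then show "(\<lambda>j. axis j 1) ` J
        \<subseteq> vec.span {model_bracket x y |x y. x \<in> UNIV \<and> y \<in> {x :: 'k ^ 4. \<forall>j. j \<notin> I \<longrightarrow> x $ j = 0}}"
      using assms(4) by (blast intro: vec.span_base)
  qed
  finally show ?thesis unfolding span_axes .
qed

lemma model_lower_central:
  "model.lower_central 2 = {x :: 'k::field ^ 4. \<forall>j. j \<notin> {3, 4} \<longrightarrow> x $ j = 0}"
  "model.lower_central 3 = {x :: 'k ^ 4. \<forall>j. j \<notin> {4} \<longrightarrow> x $ j = 0}"
  "model.lower_central 4 = {x :: 'k ^ 4. \<forall>j. j \<notin> {} \<longrightarrow> x $ j = 0}"
proof -
  have e: "axis 3 (1::'k) = model_bracket (axis 1 1) (axis 2 1)"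
    "axis 4 (1::'k) = model_bracket (axis 1 1) (axis 3 1)"
    by (simp_all add: vec_eq_iff forall_4 model_bracket_nth axis_def)
  have "model.lower_central (Suc 1) = {x :: 'k ^ 4. \<forall>j. j \<notin> {3, 4} \<longrightarrow> x $ j = 0}"
  proof (rule model_lower_central_Suc[where I = UNIV])
    show "\<exists>k\<in>UNIV. axis j (1::'k) = model_bracket (axis 1 1) (axis k 1)" if "j \<in> {3, 4}" for j
      using that e by blast
  qed (auto simp: forall_4 model_bracket_nth)
  then show C2: "model.lower_central 2 = {x :: 'k ^ 4. \<forall>j. j \<notin> {3, 4} \<longrightarrow> x $ j = 0}"
    by (simp only: Suc_1)
  have "model.lower_central (Suc 2) = {x :: 'k ^ 4. \<forall>j. j \<notin> {4} \<longrightarrow> x $ j = 0}"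
  proof (rule model_lower_central_Suc[OF _ C2])
    show "\<exists>k\<in>{3, 4}. axis j (1::'k) = model_bracket (axis 1 1) (axis k 1)" if "j \<in> {4}" for j
      using that e by blast
  qed (auto simp: forall_4 model_bracket_nth)
  moreover have "Suc 2 = 3" by simp
  ultimately show C3: "model.lower_central 3 = {x :: 'k ^ 4. \<forall>j. j \<notin> {4} \<longrightarrow> x $ j = 0}"
    by metis
  have "model.lower_central (Suc 3) = {x :: 'k ^ 4. \<forall>j. j \<notin> {} \<longrightarrow> x $ j = 0}"
    by (rule model_lower_central_Suc[OF _ C3]) (auto simp: forall_4 model_bracket_nth)
  moreover have "Suc 3 = 4" by simp
  ultimately show "model.lower_central 4 = {x :: 'k ^ 4. \<forall>j. j \<notin> {} \<longrightarrow> x $ j = 0}"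
    by metis
qed

lemma dim_UNIV_vec_4: "vec.dim (UNIV :: ('k::field ^ 4) set) = 4"
  by (simp only: vec_dim_card) simp

lemma model_filiform: "finite_dimensional_lie_algebra.filiform (*s) (model_bracket :: 'k::field ^ 4 \<Rightarrow> _)"
proof -
  have "{2..4} = {2, 3, 4 :: nat}" by auto
  then show ?thesis
    unfolding model.filiform_def dim_UNIV_vec_4
    by (simp only: ball_simps model_lower_central dim_vanishing_coordinates) simp
qed

text \<open>
  The coordinate functional \<open>\<xi> = e\<^sub>4\<^sup>*\<close> has the stabilizer spanned by \<open>e\<^sub>2\<close> and \<open>e\<^sub>4\<close>. For an
  arbitrary \<open>\<xi>\<close> the stabilizer contains the central vector \<open>e\<^sub>4\<close> and a nonzero combination of
  \<open>e\<^sub>2\<close> and \<open>e\<^sub>3\<close>, namely one that \<open>ad e\<^sub>1\<close> sends into the kernel of \<open>\<xi>\<close>.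
\<close>

lemma model_index: "lie_algebra.index (*s) (model_bracket :: 'k::field ^ 4 \<Rightarrow> _) = 2"
  unfolding model.index_def
proof (rule Least_equality)
  have lin: "Vector_Spaces.linear (*s) (*) (\<lambda>x :: 'k ^ 4. x $ 4)"
    unfolding Vector_Spaces.linear_iff
    by (intro conjI vec.vector_space_axioms vector_space_mult) simp_all
  have "model.stabilizer (\<lambda>x :: 'k ^ 4. x $ 4) = {x. \<forall>j. j \<notin> {2, 4} \<longrightarrow> x $ j = 0}"
  proof -
    have "x $ 3 = 0 \<and> x $ 1 = 0" if "\<forall>y :: 'k ^ 4. x $ 1 * y $ 3 = x $ 3 * y $ 1" for x :: "'k ^ 4"
      using spec[OF that, of "axis 1 1"] spec[OF that, of "axis 3 1"] by (simp add: axis_def)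
    then show ?thesis
      by (auto simp: model.stabilizer_def model_bracket_nth forall_4)
  qed
  then have "vec.dim (model.stabilizer (\<lambda>x :: 'k ^ 4. x $ 4)) = 2"
    by (simp only: dim_vanishing_coordinates) simp
  with lin show "\<exists>\<xi> :: 'k ^ 4 \<Rightarrow> 'k. Vector_Spaces.linear (*s) (*) \<xi> \<and> 2 = vec.dim (model.stabilizer \<xi>)"
    by metis
next
  fix d assume "\<exists>\<xi> :: 'k ^ 4 \<Rightarrow> 'k. Vector_Spaces.linear (*s) (*) \<xi> \<and> d = vec.dim (model.stabilizer \<xi>)"
  then obtain \<xi> :: "'k ^ 4 \<Rightarrow> 'k"
    where \<xi>: "Vector_Spaces.linear (*s) (*) \<xi>" "d = vec.dim (model.stabilizer \<xi>)" by blast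
  define a b where "a = \<xi> (axis 3 1)" and "b = \<xi> (axis 4 1)"
  have form: "\<xi> (model_bracket x y)
      = (x $ 1 * y $ 2 - x $ 2 * y $ 1) * a + (x $ 1 * y $ 3 - x $ 3 * y $ 1) * b" for x y
    using \<xi>(1) unfolding Vector_Spaces.linear_iff model_bracket_def a_def b_def by metis
  have stab: "x \<in> model.stabilizer \<xi>" if "x $ 1 = 0" "x $ 2 * a + x $ 3 * b = 0" for x
  proof -
    have "\<xi> (model_bracket x y) = - (x $ 2 * a + x $ 3 * b) * y $ 1" for y
      unfolding form using that(1) by (simp add: algebra_simps)
    then show ?thesis using that(2) by (simp add: model.stabilizer_def)
  qed
  \<comment> \<open>One linear equation in two unknowns has a nontrivial solution.\<close>
  obtain s t where st: "s * a + t * b = 0" "s \<noteq> 0 \<or> t \<noteq> 0"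
  proof (cases "a = 0 \<and> b = 0")
    case True then show ?thesis using that[of 1 0] by simp
  next
    case False then show ?thesis using that[of b "- a"] by (auto simp: algebra_simps)
  qed
  define v :: "'k ^ 4" where "v = s *s axis 2 1 + t *s axis 3 1"
  have v: "v $ 1 = 0" "v $ 2 = s" "v $ 3 = t" "v $ 4 = 0"
    by (simp_all add: v_def axis_def)
  have "v \<notin> vec.span {axis 4 1}"
    using st(2) v unfolding vec.span_singleton by (auto simp: axis_def vec_eq_iff forall_4)
  then have "vec.independent {v, axis 4 1}" "v \<noteq> axis 4 1"
    by (auto simp: vec.independent_insert vec.span_base axis_eq_0_iff)
  moreover have "{v, axis 4 1} \<subseteq> model.stabilizer \<xi>"
    using st(1) by (auto intro!: stab simp: v) (simp_all add: axis_def)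
  ultimately show "2 \<le> d"
    using vec.independent_card_le_dim[of "{v, axis 4 1}" "model.stabilizer \<xi>"] \<xi>(2) by simp
qed

lemma model_CP: "\<exists>P. lie_algebra.CP (*s) (model_bracket :: 'k::field ^ 4 \<Rightarrow> _) P"
proof
  let ?P = "vec.span ((\<lambda>i. axis i (1::'k)) ` {2, 3, 4}) :: ('k ^ 4) set"
  have "model.abelian_subalgebra ?P"
    by (rule model.abelian_subalgebra_span)
      (auto simp: vec_eq_iff forall_4 model_bracket_nth axis_def)
  moreover have "vec.dim ?P = 3"
    unfolding span_axes dim_vanishing_coordinates by simp
  ultimately show "model.CP ?P"
    unfolding model.CP_def model.magic_number_def model_index dim_UNIV_vec_4 by simp
qed

section \<open>Rentschler's property for filiform Lie algebras of minimal index\<close>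

theorem proposition8p5:
  fixes scale :: "'k::{alg_closed_field, field_char_0} \<Rightarrow> 'v::ab_group_add \<Rightarrow> 'v"
    and bracket :: "'v \<Rightarrow> 'v \<Rightarrow> 'v"
    and n q :: nat
    and H :: "'v set"
  assumes L: "finite_dimensional_lie_algebra scale bracket"
    and n: "n = vector_space.dim scale (UNIV :: 'v set)"
    and filiform: "finite_dimensional_lie_algebra.filiform scale bracket"
    and q: "q = (n + 1) div 2"
    and H: "H = lie_algebra.lower_central scale bracket (n - q)"
  shows
    "(n \<ge> 4 \<longrightarrow> lie_algebra.abelian_ideal scale bracket H \<and> vector_space.dim scale H = q)
     \<and> finite_dimensional_lie_algebra.alpha scale bracket \<ge> q
     \<and> (finite_dimensional_lie_algebra.minimal_index scale bracket \<longrightarrow>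
          lie_algebra.rentschler_property scale bracket
          \<and> (lie_algebra.index scale bracket = 1 \<longrightarrow>
               odd n
               \<and> (n \<ge> 4 \<longrightarrow> lie_algebra.CP scale bracket H)
               \<and> finite_dimensional_lie_algebra.alpha scale bracket = q)
          \<and> (lie_algebra.index scale bracket = 2 \<longrightarrow>
               even n
               \<and> (n \<ge> 4 \<longrightarrow> vector_space.dim scale H = q)
               \<and> of_nat q = lie_algebra.magic_number scale bracket - 1))
     \<and> (\<exists>br :: 'k ^ 4 \<Rightarrow> 'k ^ 4 \<Rightarrow> 'k ^ 4.
          finite_dimensional_lie_algebra (*s) br
          \<and> finite_dimensional_lie_algebra.filiform (*s) br
          \<and> lie_algebra.index (*s) br = 2
          \<and> (\<exists>P. lie_algebra.CP (*s) br P))"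
  proof -
  interpret finite_dimensional_lie_algebra scale bracket by (rule L)
  obtain A where A: "abelian_subalgebra A" "dim A = q"
    using filiform_abelian_subalgebra[OF filiform n] q by blast
  have H_half: "abelian_ideal H" "dim H = q" if "n \<ge> 4"
    using filiform_half_step[OF filiform n that] H q by auto
  have alpha_ge: "q \<le> alpha" using dim_le_alpha[OF A(1)] A(2) by simp
  have odd_case: "odd n" "of_nat q = magic_number" "alpha = q" if "minimal_index" "index = 1"
  proof -
    show "odd n"
      using that n unfolding minimal_index_def by (metis one_eq_numeral_iff semiring_norm(83))
    then have q2: "2 * q = n + 1" using q by auto
    then have "of_nat (2 * q) = (of_nat (n + 1) :: rat)" by simp
    then show "of_nat q = magic_number"
      unfolding magic_number_def using that(2) n by simp
    have "alpha \<le> q"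
    proof (rule alpha_le)
      fix B assume "abelian_subalgebra B"
      then show "dim B \<le> q" using dim_abelian_subalgebra_le[of B] that(2) q2 n by simp
    qed
    then show "alpha = q" using alpha_ge by simp
  qed
  have even_case: "even n" "of_nat q = magic_number - 1" if "minimal_index" "index = 2"
  proof -
    show "even n"
      using that n unfolding minimal_index_def by (metis one_eq_numeral_iff semiring_norm(83))
    then have "2 * q = n" using q by auto
    then have "of_nat (2 * q) = (of_nat n :: rat)" by simp
    then show "of_nat q = magic_number - 1"
      unfolding magic_number_def using that(2) n by (simp add: field_simps)
  qed
  have rentschler: "rentschler_property" if min: "minimal_index"
  proof (cases "odd n")
    case True
    then have "index = 1" using min n by (simp add: minimal_index_def)
    then show ?thesis
      using odd_case(2)[OF min] A unfolding rentschler_property_def CP_def by auto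
  next
    case False
    then have "index = 2" using min n by (simp add: minimal_index_def)
    then show ?thesis
      using even_case(2)[OF min] A unfolding rentschler_property_def by auto
  qed
  have CP_H: "CP H" if "minimal_index" "index = 1" "n \<ge> 4"
    using H_half[OF that(3)] odd_case(2)[OF that(1,2)] abelian_ideal_imp_abelian_subalgebra
    by (simp add: CP_def)
  show ?thesis
    using H_half alpha_ge odd_case even_case rentschler CP_H
      model.finite_dimensional_lie_algebra_axioms model_filiform model_index model_CP
    by blast
qed

end
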